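(* Let $p\in[0,1)$. Assume that the bilevel problem $$\min_{x\in\mathcal X,\ \eta\in\mathbb R} f(x)\quad\text{s.t.}\quad \eta\le0,\quad \eta\in\operatorname{arg\,min}_{s\in\mathbb R}G(x,s)$$ has a non-empty feasible set. Let $(\mu_k)_{k\ge0}$ be an increasing sequence of positive reals with $\mu_k\to\infty$, and let $(\lambda_k)_{k\ge0}$ be such that $\lambda_k>\mu_k/\delta$ for all $k$. Suppose that for every $k$ there exists a solution, denoted $(x_k,\eta_k)$, of $$(P_{\lambda_k,\mu_k})\qquad \min_{(x,\eta)\in\mathcal X\times\mathbb R} f(x)+\lambda_k\Big(G(x,\eta)-\min_{s\in\mathbb R}G(x,s)\Big)+\mu_k\max(\eta,0).$$ Then any cluster point $(\bar x,\bar\eta)$ of the sequence $((x_k,\eta_k))_{k\ge0}$ is optimal for the chance-constrained problem $$\min_{x\in\mathcal X} f(x)\quad\text{s.t.}\quad \mathbb P[g(x,\xi)\le0]\ge p,$$ in the sense that $\bar x$ is an optimal solution of it.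
   Context: $\mathcal X\subset\mathbb R^d$ is a closed set, $f:\mathbb R^d\to\mathbb R$ is convex, $g:\mathbb R^d\times\mathbb R^m\to\mathbb R$ is convex in its first argument. The random vector $\xi$ follows an equiprobable discrete distribution: there are $\xi_1,\dots,\xi_n\in\mathbb R^m$ ($n\ge1$) with $\mathbb P[\xi=\xi_i]=\frac1n$ for all $i\in\{1,\dots,n\}$. Define $$G(x,s)=s+\frac{1}{1-p}\,\mathbb E[\max(g(x,\xi)-s,0)].$$ Let $\mathcal I_n=\{\frac in:\ i\in\{0,\dots,n-1\}\}$, let $d_{\mathcal I_n}(p)$ denote the distance from $p$ to $\mathcal I_n$, and define $$\delta=\frac{1}{n(1-p)}\ \text{ if } p\in\mathcal I_n,\qquad \delta=\frac{d_{\mathcal I_n}(p)}{1-p}\ \text{ otherwise.}$$ *)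

theory Defs
  imports "HOL-Probability.Probability"
begin

definition G_fun ::
  "'w measure \<Rightarrow> ('w \<Rightarrow> real ^ 'm) \<Rightarrow> (real ^ 'd \<Rightarrow> real ^ 'm \<Rightarrow> real) \<Rightarrow> real \<Rightarrow> real ^ 'd \<Rightarrow> real \<Rightarrow> real"
  where "G_fun M \<xi> g p x s = s + 1 / (1 - p) * (\<integral>\<omega>. max (g x (\<xi> \<omega>) - s) 0 \<partial>M)"

definition I_set :: "nat \<Rightarrow> real set"
  where "I_set n = {real i / real n | i. i < n}"

definition delta :: "nat \<Rightarrow> real \<Rightarrow> real"
  where "delta n p =
    (if p \<in> I_set n then 1 / (real n * (1 - p)) else infdist p (I_set n) / (1 - p))"

definition bilevel_feasible ::
  "'w measure \<Rightarrow> ('w \<Rightarrow> real ^ 'm) \<Rightarrow> (real ^ 'd \<Rightarrow> real ^ 'm \<Rightarrow> real) \<Rightarrow> real \<Rightarrow> (real ^ 'd) set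
    \<Rightarrow> ((real ^ 'd) \<times> real) set"
  where "bilevel_feasible M \<xi> g p X =
    {(x, \<eta>). x \<in> X \<and> \<eta> \<le> 0 \<and> is_arg_min (G_fun M \<xi> g p x) (\<lambda>s. True) \<eta>}"

text \<open>If \<open>g x (\<xi> \<omega>)\<close> is integrable in \<open>\<omega>\<close> and bounded almost surely, then for \<open>0 \<le> p < 1\<close> the function
  \<open>G_fun M \<xi> g p x\<close> of \<open>s\<close> attains its infimum, so \<open>INF\<close> below is the minimum over all reals.\<close>

definition penalized_objective ::
  "'w measure \<Rightarrow> ('w \<Rightarrow> real ^ 'm) \<Rightarrow> (real ^ 'd \<Rightarrow> real ^ 'm \<Rightarrow> real) \<Rightarrow> real \<Rightarrow> (real ^ 'd \<Rightarrow> real)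
    \<Rightarrow> real \<Rightarrow> real \<Rightarrow> (real ^ 'd) \<times> real \<Rightarrow> real"
  where "penalized_objective M \<xi> g p f l m = (\<lambda>(x, \<eta>).
    f x + l * (G_fun M \<xi> g p x \<eta> - (INF s. G_fun M \<xi> g p x s)) + m * max \<eta> 0)"

definition cluster_point :: "(nat \<Rightarrow> 'a::metric_space) \<Rightarrow> 'a \<Rightarrow> bool"
  where "cluster_point u z \<longleftrightarrow> (\<exists>r. strict_mono r \<and> (u \<circ> r) \<longlonglongrightarrow> z)"

end

theory Submission
  imports Defs
begin

text \<open>Left of the \<open>p\<close>-quantile \<open>q\<close> of \<open>g x \<xi>\<close>, the piecewise affine function \<open>G x\<close> has slopes at most
  \<open>- \<delta>\<close>. Hence, when \<open>\<lambda> \<delta> \<ge> \<mu>\<close>, undercutting \<open>q > 0\<close> costs at least as much as it saves in the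
  term \<open>\<mu> max \<eta> 0\<close>, so that the penalised value at \<open>(x, \<eta>)\<close> is at least \<open>f x + \<mu> max q 0\<close>. On the other
  hand it is at most \<open>f y\<close> for every \<open>y\<close> satisfying the chance constraint, since then \<open>G y\<close> has a
  nonpositive minimiser. Letting \<open>\<mu>\<close> tend to infinity forces the quantile to be nonpositive in the limit.\<close>

section \<open>The Rockafellar-Uryasev objective for the conditional value-at-risk of a finite
  sample\<close>

definition G_emp :: "nat \<Rightarrow> real \<Rightarrow> (nat \<Rightarrow> real) \<Rightarrow> real \<Rightarrow> real" where
  "G_emp n p a s = s + 1 / (1 - p) * ((\<Sum>i=1..n. max (a i - s) 0) / real n)"

text \<open>This is \<open>n\<close> times the empirical distribution function. Keeping it an
  integer lets \<open>delta_le\<close> compare it with grid points.\<close>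

definition count_le :: "nat \<Rightarrow> (nat \<Rightarrow> real) \<Rightarrow> real \<Rightarrow> nat" where
  "count_le n a u = card {i\<in>{1..n}. a i \<le> u}"

lemma count_gr: "card {i\<in>{1..n}. \<not> a i \<le> u} = n - count_le n a u" and count_le_le: "count_le n a u \<le> n"
proof -
  have "card ({i\<in>{1..n}. a i \<le> u} \<union> {i\<in>{1..n}. \<not> a i \<le> u})
      = card {i\<in>{1..n}. a i \<le> u} + card {i\<in>{1..n}. \<not> a i \<le> u}"
    by (rule card_Un_disjoint) auto
  moreover have "{i\<in>{1..n}. a i \<le> u} \<union> {i\<in>{1..n}. \<not> a i \<le> u} = {1..n}" by auto
  ultimately show "card {i\<in>{1..n}. \<not> a i \<le> u} = n - count_le n a u" "count_le n a u \<le> n"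
    by (auto simp: count_le_def)
qed

lemma sum_count_gr:
  fixes c :: real
  shows "(\<Sum>i=1..n. if a i \<le> u then 0 else c) = (real n - real (count_le n a u)) * c"
proof -
  have "(\<Sum>i=1..n. if a i \<le> u then 0 else c) = (\<Sum>i\<in>{i\<in>{1..n}. \<not> a i \<le> u}. c)"
    by (rule sum.mono_neutral_cong_right) auto
  then show ?thesis
    using count_le_le[of n a u] unfolding sum_constant count_gr by (simp add: of_nat_diff)
qed

text \<open>Subgradient inequality at \<open>e\<close>: each term with \<open>a i > e\<close> grows
  by exactly \<open>e - t\<close> when \<open>s\<close> drops from \<open>e\<close> to
  \<open>t\<close>, and no other term shrinks. The fraction is minus the right derivative of
  \<open>G_emp n p a\<close> at \<open>e\<close>.\<close>

lemma G_emp_diff_ge: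
  fixes p :: real
  assumes "n \<ge> 1" "p < 1" "t \<le> e"
  shows "(e - t) * ((p - count_le n a e / n) / (1 - p)) \<le> G_emp n p a t - G_emp n p a e"
proof -
  have "(\<Sum>i=1..n. max (a i - e) 0) + (\<Sum>i=1..n. if a i \<le> e then 0 else e - t)
      \<le> (\<Sum>i=1..n. max (a i - t) 0)"
    unfolding sum.distrib[symmetric] using \<open>t \<le> e\<close> by (intro sum_mono) auto
  then have "(real n - count_le n a e) * (e - t) \<le> (\<Sum>i=1..n. max (a i - t) 0) - (\<Sum>i=1..n. max (a i - e) 0)"
    unfolding sum_count_gr by simp
  then have "(real n - count_le n a e) * (e - t) / n
      \<le> (\<Sum>i=1..n. max (a i - t) 0) / n - (\<Sum>i=1..n. max (a i - e) 0) / n"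
    unfolding diff_divide_distrib[symmetric] by (rule divide_right_mono) simp
  then have "1 / (1 - p) * ((real n - count_le n a e) * (e - t) / n)
      \<le> 1 / (1 - p) * ((\<Sum>i=1..n. max (a i - t) 0) / n - (\<Sum>i=1..n. max (a i - e) 0) / n)"
    using \<open>p < 1\<close> by (intro mult_left_mono) auto
  moreover have "1 / (1 - p) * ((real n - count_le n a e) * (e - t) / n) - (e - t)
      = (e - t) * ((p - count_le n a e / n) / (1 - p))"
    using assms by (simp add: field_simps)
  ultimately show ?thesis
    unfolding G_emp_def by (simp add: right_diff_distrib)
qed

text \<open>At most a fraction \<open>1 - p\<close> of the values exceeds \<open>u\<close>, so to
  the right of \<open>u\<close> the averaged excess, divided by \<open>1 - p\<close>, falls no
  faster than the summand \<open>s\<close> rises.\<close>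

lemma G_emp_mono_right:
  fixes p :: real
  assumes "n \<ge> 1" "p < 1" "p * n \<le> count_le n a u" "u \<le> t"
  shows "G_emp n p a u \<le> G_emp n p a t"
proof -
  have "(\<Sum>i=1..n. max (a i - u) 0) \<le> (\<Sum>i=1..n. max (a i - t) 0) + (\<Sum>i=1..n. if a i \<le> u then 0 else t - u)"
    unfolding sum.distrib[symmetric] using \<open>u \<le> t\<close> by (intro sum_mono) auto
  then have "(\<Sum>i=1..n. max (a i - u) 0) - (\<Sum>i=1..n. max (a i - t) 0)
      \<le> (real n - count_le n a u) * (t - u)"
    unfolding sum_count_gr by simp
  also have "\<dots> \<le> (n * (1 - p)) * (t - u)"
    using assms by (intro mult_right_mono) (auto simp: algebra_simps)
  finally have "((\<Sum>i=1..n. max (a i - u) 0) - (\<Sum>i=1..n. max (a i - t) 0)) / (n * (1 - p)) \<le> t - u"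
    using assms by (simp add: divide_le_eq mult.commute)
  then show ?thesis
    unfolding G_emp_def by (simp add: diff_divide_distrib mult.commute)
qed

text \<open>Below all sample values every positive part is active, so the function is affine there
  with slope \<open>1 - 1 / (1 - p) = - p / (1 - p)\<close>.\<close>

lemma G_emp_antimono_left:
  fixes p :: real
  assumes "n \<ge> 1" "0 \<le> p" "p < 1" "\<And>i. i \<in> {1..n} \<Longrightarrow> l \<le> a i" "s \<le> l"
  shows "G_emp n p a l \<le> G_emp n p a s"
proof -
  have "(\<Sum>i=1..n. max (a i - s) 0) = (\<Sum>i=1..n. max (a i - l) 0 + (l - s))"
    using assms by (intro sum.cong) force+
  also have "\<dots> / n = (\<Sum>i=1..n. max (a i - l) 0) / n + (l - s)"
    using assms(1) by (simp add: sum.distrib add_divide_distrib)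
  finally have "G_emp n p a s - G_emp n p a l = (l - s) / (1 - p) - (l - s)"
    unfolding G_emp_def by (simp add: distrib_left)
  also have "\<dots> = (l - s) * (p / (1 - p))"
    using assms(3) by (simp add: field_simps)
  also have "\<dots> \<ge> 0"
    using assms by simp
  finally show ?thesis by simp
qed

text \<open>Monotonicity on both sides confines the minimisation to a compact interval. With
  \<open>u = 0\<close>, the bound \<open>t \<le> u\<close> turns the chance constraint into
  feasibility for the bilevel problem.\<close>

lemma G_emp_minimiser:
  fixes p :: real
  assumes "n \<ge> 1" "0 \<le> p" "p < 1" "p * n \<le> count_le n a u"
  obtains t where "t \<le> u" "\<And>s. G_emp n p a t \<le> G_emp n p a s"
proof -
  \<comment> \<open>Taking the minimum with \<open>u\<close> keeps \<open>{l..u}\<close> non-empty: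
    for \<open>p = 0\<close> all values may lie above \<open>u\<close>.\<close>
  define l where "l = min u (Min (a ` {1..n}))"
  have l: "l \<le> u" "\<And>i. i \<in> {1..n} \<Longrightarrow> l \<le> a i"
    by (auto simp: l_def min_le_iff_disj)
  have "continuous_on {l..u} (G_emp n p a)"
    unfolding G_emp_def using \<open>n \<ge> 1\<close> \<open>p < 1\<close> by (intro continuous_intros) auto
  then obtain t where t: "t \<in> {l..u}" "\<forall>s\<in>{l..u}. G_emp n p a t \<le> G_emp n p a s"
    using continuous_attains_inf[of "{l..u}" "G_emp n p a"] l(1) by auto
  have "G_emp n p a t \<le> G_emp n p a s" for s
  proof -
    consider "s \<le> l" | "s \<in> {l..u}" | "u \<le> s" by fastforce
    then show ?thesis
    proof cases
      case 1
      then show ?thesis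
        using G_emp_antimono_left[of n p l a s] assms l t(2)
        by (meson atLeastAtMost_iff order_refl order_trans)
    next
      case 3
      then show ?thesis
        using G_emp_mono_right[of n p a u s] assms l(1) t(2)
        by (meson atLeastAtMost_iff order_refl order_trans)
    qed (use t in auto)
  qed
  with t(1) show ?thesis by (intro that[of t]) auto
qed

lemma bdd_below_G_emp:
  fixes p :: real
  assumes "n \<ge> 1" "0 \<le> p" "p < 1"
  shows "bdd_below (range (G_emp n p a))"
proof -
  have "{i\<in>{1..n}. a i \<le> Max (a ` {1..n})} = {1..n}"
    by auto
  then have "count_le n a (Max (a ` {1..n})) = n"
    by (simp add: count_le_def)
  then have "p * n \<le> count_le n a (Max (a ` {1..n}))"
    using assms by (simp add: mult_left_le_one_le)
  from G_emp_minimiser[OF assms this] show ?thesis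
    by (metis bdd_belowI2)
qed

section \<open>The constant \<open>delta\<close> and the exact penalty inequality\<close>

lemma delta_pos:
  fixes p :: real
  assumes "n \<ge> 1" "p < 1"
  shows "0 < delta n p"
proof (cases "p \<in> I_set n")
  case False
  have "I_set n = (\<lambda>i. real i / real n) ` {..<n}"
    by (auto simp: I_set_def)
  then have "closed (I_set n)" "I_set n \<noteq> {}"
    using assms by (auto intro!: finite_imp_closed simp: lessThan_empty_iff)
  then have "0 < infdist p (I_set n)"
    using False by (simp add: infdist_pos_not_in_closed)
  then show ?thesis
    using False assms by (simp add: delta_def)
qed (use assms in \<open>simp add: delta_def\<close>)

text \<open>A grid point strictly below \<open>p\<close> is at least \<open>1 / n\<close> away if
  \<open>p\<close> is on the grid, and at least the distance to the grid otherwise. By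
  \<open>G_emp_diff_ge\<close>, \<open>delta\<close> thus bounds from below the steepness left of
  the quantile.\<close>

lemma delta_le:
  fixes p :: real
  assumes "n \<ge> 1" "p < 1" "real j < p * n"
  shows "delta n p \<le> (p - j / n) / (1 - p)"
proof (cases "p \<in> I_set n")
  case True
  then obtain i where i: "i < n" "p = real i / real n"
    by (auto simp: I_set_def)
  then have "j < i"
    using assms by simp
  then have "1 / real n \<le> p - j / n"
    using assms i by (simp add: diff_divide_distrib[symmetric] divide_right_mono)
  then have "1 / real n / (1 - p) \<le> (p - j / n) / (1 - p)"
    using assms by (intro divide_right_mono) auto
  then show ?thesis
    using True by (simp add: delta_def)
next
  case False
  \<comment> \<open>The grid stops at \<open>(n - 1) / n\<close>, so \<open>j < n\<close> must hold
    before \<open>j / n\<close> can be compared with \<open>infdist\<close>.\<close>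
  have "p * n < n"
    using assms by simp
  then have "j < n"
    using assms by linarith
  then have "infdist p (I_set n) \<le> dist p (j / n)"
    by (intro infdist_le) (auto simp: I_set_def)
  also have "\<dots> = p - j / n"
    using assms by (simp add: dist_real_def field_simps)
  finally show ?thesis
    using False assms by (simp add: delta_def divide_right_mono)
qed

text \<open>Any level \<open>e\<close> below the quantile serves in its place. For
  \<open>t \<le> e\<close> the suboptimality of \<open>t\<close> costs at least the saving
  \<open>m * (e - t)\<close>; for \<open>t > e\<close> the term \<open>m * max t 0\<close> alone
  suffices.\<close>

lemma G_emp_penalty_ge:
  fixes p :: real
  assumes "n \<ge> 1" "0 \<le> p" "p < 1" "count_le n a e < p * n" "0 \<le> e" "0 \<le> m" "m \<le> l * delta n p"
  shows "m * e \<le> l * (G_emp n p a t - (INF s. G_emp n p a s)) + m * max t 0"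
proof -
  have "0 \<le> l * delta n p"
    using assms(6,7) by linarith
  then have "0 \<le> l"
    using delta_pos[OF assms(1,3)] by (simp add: zero_le_mult_iff)
  have Inf: "(INF s. G_emp n p a s) \<le> G_emp n p a s" for s
    using bdd_below_G_emp assms by (intro cINF_lower) auto
  show ?thesis
  proof (cases "t \<le> e")
    case True
    have "m * (e - t) \<le> l * ((e - t) * delta n p)"
      using assms(7) True mult_right_mono[of m "l * delta n p" "e - t"] by (simp add: mult.commute mult.left_commute)
    also have "(e - t) * delta n p \<le> (e - t) * ((p - count_le n a e / n) / (1 - p))"
      using delta_le assms True by (intro mult_left_mono) auto
    also have "\<dots> \<le> G_emp n p a t - G_emp n p a e"
      using G_emp_diff_ge assms True by blast
    also have "\<dots> \<le> G_emp n p a t - (INF s. G_emp n p a s)"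
      using Inf by simp
    finally have "m * (e - t) \<le> l * (G_emp n p a t - (INF s. G_emp n p a s))"
      using \<open>0 \<le> l\<close> by (simp add: mult_left_mono)
    moreover have "m * t \<le> m * max t 0"
      using assms by (intro mult_left_mono) auto
    ultimately show ?thesis
      by (simp add: right_diff_distrib)
  next
    case False
    then have "m * e \<le> m * max t 0"
      using assms by (intro mult_left_mono) auto
    moreover have "0 \<le> l * (G_emp n p a t - (INF s. G_emp n p a s))"
      using Inf \<open>0 \<le> l\<close> by simp
    ultimately show ?thesis by simp
  qed
qed

section \<open>From the probability space to finite averages\<close>

lemma (in prob_space) expectation_equiprobable:
  fixes h :: "'b :: t1_space \<Rightarrow> real"
  assumes [measurable]: "\<xi> \<in> borel_measurable M" "(\<lambda>\<omega>. h (\<xi> \<omega>)) \<in> borel_measurable M"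
    and n: "n \<ge> 1" and inj: "inj_on \<xi>s {1..n}"
    and prob: "\<And>i. i \<in> {1..n} \<Longrightarrow> \<P>(\<omega> in M. \<xi> \<omega> = \<xi>s i) = 1 / real n"
  shows "expectation (\<lambda>\<omega>. h (\<xi> \<omega>)) = (\<Sum>i=1..n. h (\<xi>s i)) / n"
proof -
  define E where "E i = {\<omega>\<in>space M. \<xi> \<omega> = \<xi>s i}" for i
  have E[measurable]: "E i \<in> events" for i
    unfolding E_def by measurable
  have "E i \<inter> E j = {}" if "i \<in> {1..n}" "j \<in> {1..n}" "i \<noteq> j" for i j
    using inj_onD[OF inj _ that(1,2)] that(3) by (auto simp: E_def)
  then have "disjoint_family_on E {1..n}"
    unfolding disjoint_family_on_def by blast
  \<comment> \<open>The \<open>n\<close> disjoint events of mass \<open>1 / n\<close> exhaust the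
    total probability, so \<open>h (\<xi> \<omega>)\<close> agrees almost surely with a simple
    function.\<close>
  then have "prob (\<Union>i\<in>{1..n}. E i) = (\<Sum>i=1..n. prob (E i))"
    using E by (intro finite_measure_finite_Union) auto
  also have "\<dots> = 1"
    using prob n by (simp add: E_def)
  finally have "AE \<omega> in M. \<omega> \<in> (\<Union>i\<in>{1..n}. E i)"
    by (rule AE_prob_1)
  then have "AE \<omega> in M. h (\<xi> \<omega>) = (\<Sum>i=1..n. h (\<xi>s i) * indicator (E i) \<omega>)"
  proof eventually_elim
    case (elim \<omega>)
    then obtain j where j: "j \<in> {1..n}" "\<omega> \<in> E j" by auto
    then have "\<omega> \<in> E i \<longleftrightarrow> i = j" if "i \<in> {1..n}" for i
      using inj_on_eq_iff[OF inj that j(1)] j(2) by (auto simp: E_def)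
    then have "(\<Sum>i=1..n. h (\<xi>s i) * indicator (E i) \<omega>) = (\<Sum>i=1..n. if i = j then h (\<xi>s i) else 0)"
      by (intro sum.cong) (auto simp: indicator_def)
    also have "\<dots> = h (\<xi>s j)"
      using j by simp
    finally show ?case
      using j by (simp add: E_def)
  qed
  then have "expectation (\<lambda>\<omega>. h (\<xi> \<omega>)) = expectation (\<lambda>\<omega>. \<Sum>i=1..n. h (\<xi>s i) * indicator (E i) \<omega>)"
    by (intro integral_cong_AE) measurable
  also have "\<dots> = (\<Sum>i=1..n. h (\<xi>s i) * prob (E i))"
    by (subst Bochner_Integration.integral_sum) (use E in \<open>auto intro!: integrable_real_indicator simp: emeasure_eq_measure\<close>)
  also have "\<dots> = (\<Sum>i=1..n. h (\<xi>s i)) / n"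
    using prob by (simp add: E_def sum_divide_distrib)
  finally show ?thesis .
qed

lemma (in prob_space) prob_equiprobable:
  fixes h :: "'b :: t1_space \<Rightarrow> real"
  assumes "\<xi> \<in> borel_measurable M" and [measurable]: "(\<lambda>\<omega>. h (\<xi> \<omega>)) \<in> borel_measurable M"
    and "n \<ge> 1" "inj_on \<xi>s {1..n}"
    and "\<And>i. i \<in> {1..n} \<Longrightarrow> \<P>(\<omega> in M. \<xi> \<omega> = \<xi>s i) = 1 / real n"
  shows "\<P>(\<omega> in M. h (\<xi> \<omega>) \<le> u) = count_le n (\<lambda>i. h (\<xi>s i)) u / n"
proof -
  have "\<P>(\<omega> in M. h (\<xi> \<omega>) \<le> u) = expectation (indicator {\<omega>\<in>space M. h (\<xi> \<omega>) \<le> u})"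
    by simp
  also have "\<dots> = expectation (\<lambda>\<omega>. (\<lambda>z. if h z \<le> u then 1 else 0) (\<xi> \<omega>))"
    by (intro Bochner_Integration.integral_cong) (auto simp: indicator_def)
  also have "\<dots> = (\<Sum>i=1..n. if h (\<xi>s i) \<le> u then 1 else 0) / n"
    by (rule expectation_equiprobable) (use assms in measurable)
  also have "(\<Sum>i=1..n. if h (\<xi>s i) \<le> u then 1 else 0) = real (count_le n (\<lambda>i. h (\<xi>s i)) u)"
    by (simp add: count_le_def sum.If_cases Int_def)
  finally show ?thesis .
qed

section \<open>Passage to the limit along the penalised solutions\<close>

theorem proposition6:
  fixes M :: "'w measure"
    and \<xi> :: "'w \<Rightarrow> real ^ 'm"
    and \<xi>s :: "nat \<Rightarrow> real ^ 'm"
    and n :: nat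
    and X :: "(real ^ 'd) set"
    and f :: "real ^ 'd \<Rightarrow> real"
    and g :: "real ^ 'd \<Rightarrow> real ^ 'm \<Rightarrow> real"
    and p :: real
    and \<mu> lam :: "nat \<Rightarrow> real"
    and x :: "nat \<Rightarrow> real ^ 'd"
    and \<eta> :: "nat \<Rightarrow> real"
    and xbar :: "real ^ 'd"
    and \<eta>bar :: real
  assumes "closed X"
    and "convex_on UNIV f"
    and "\<And>z. convex_on UNIV (\<lambda>y. g y z)"
    and "prob_space M"
    and "\<xi> \<in> borel_measurable M"
    and "\<And>y. y \<in> X \<Longrightarrow> (\<lambda>\<omega>. g y (\<xi> \<omega>)) \<in> borel_measurable M"
    and "n \<ge> 1"
    and "inj_on \<xi>s {1..n}"
    and "\<And>i. i \<in> {1..n} \<Longrightarrow> \<P>(\<omega> in M. \<xi> \<omega> = \<xi>s i) = 1 / real n"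
    and "0 \<le> p" "p < 1"
    and "bilevel_feasible M \<xi> g p X \<noteq> {}"
    and "incseq \<mu>"
    and "\<And>k. \<mu> k > 0"
    and "filterlim \<mu> at_top sequentially"
    and "\<And>k. lam k > \<mu> k / delta n p"
    and "\<And>k. is_arg_min (penalized_objective M \<xi> g p f (lam k) (\<mu> k)) (\<lambda>(y, t). y \<in> X) (x k, \<eta> k)"
    and "cluster_point (\<lambda>k. (x k, \<eta> k)) (xbar, \<eta>bar)"
  shows "is_arg_min f (\<lambda>y. y \<in> X \<and> \<P>(\<omega> in M. g y (\<xi> \<omega>) \<le> 0) \<ge> p) xbar"
proof -
  interpret prob_space M by fact
  define a where "a = (\<lambda>y i. g y (\<xi>s i))"
  have G: "G_fun M \<xi> g p y = G_emp n p (a y)" if "y \<in> X" for y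
  proof
    fix s
    have "(\<lambda>\<omega>. g y (\<xi> \<omega>)) \<in> borel_measurable M"
      by (rule assms(6)[OF that])
    then have "(\<lambda>\<omega>. max (g y (\<xi> \<omega>) - s) 0) \<in> borel_measurable M"
      by measurable
    then have "(\<integral>\<omega>. max (g y (\<xi> \<omega>) - s) 0 \<partial>M) = (\<Sum>i=1..n. max (g y (\<xi>s i) - s) 0) / n"
      by (rule expectation_equiprobable[where h = "\<lambda>z. max (g y z - s) 0", OF assms(5) _ assms(7,8,9)])
    then show "G_fun M \<xi> g p y s = G_emp n p (a y) s"
      by (simp add: G_fun_def G_emp_def a_def)
  qed
  have chance: "\<P>(\<omega> in M. g y (\<xi> \<omega>) \<le> 0) \<ge> p \<longleftrightarrow> p * n \<le> count_le n (a y) 0" if "y \<in> X" for y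
    using prob_equiprobable[where h = "g y", OF assms(5) assms(6)[OF that] assms(7,8,9)] \<open>n \<ge> 1\<close>
    by (simp add: a_def pos_le_divide_eq)
  have xX: "x k \<in> X" for k
    using assms(17)[of k, unfolded is_arg_min_def, THEN conjunct1] by simp
  have mu: "\<mu> k \<le> lam k * delta n p" for k
    using assms(16)[of k] delta_pos[of n p] assms(7,11) by (simp add: pos_divide_less_eq)
  have lam: "0 \<le> lam k" for k
  proof -
    have "0 \<le> lam k * delta n p"
      using assms(14)[of k] mu[of k] by linarith
    then show ?thesis
      using delta_pos[OF assms(7,11)] by (simp add: zero_le_mult_iff)
  qed
  have Inf: "(INF s. G_emp n p b s) \<le> G_emp n p b t" for b t
    using bdd_below_G_emp assms(7,10,11) by (intro cINF_lower) auto
  \<comment> \<open>A nonpositive minimiser \<open>t\<close> makes both penalty terms vanish at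
    \<open>(y, t)\<close>, which leaves a bound independent of \<open>k\<close>. It serves both
    feasibility and optimality of the limit.\<close>
  have upper: "penalized_objective M \<xi> g p f (lam k) (\<mu> k) (x k, \<eta> k) \<le> f y"
    if "y \<in> X" "t \<le> 0" "\<And>s. G_emp n p (a y) t \<le> G_emp n p (a y) s" for k y t
  proof -
    have "(INF s. G_emp n p (a y) s) = G_emp n p (a y) t"
      using that(3) by (intro cInf_eq_minimum) auto
    then have "penalized_objective M \<xi> g p f (lam k) (\<mu> k) (y, t) = f y"
      using that by (simp add: penalized_objective_def G)
    moreover have "penalized_objective M \<xi> g p f (lam k) (\<mu> k) (x k, \<eta> k)
        \<le> penalized_objective M \<xi> g p f (lam k) (\<mu> k) (y, t)"
      using assms(17)[of k] that(1) unfolding is_arg_min_linorder by blast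
    ultimately show ?thesis by simp
  qed
  have lower: "f (x k) \<le> penalized_objective M \<xi> g p f (lam k) (\<mu> k) (x k, \<eta> k)" for k
    using lam[of k] less_imp_le[OF assms(14)[of k]] Inf[of "a (x k)" "\<eta> k"] by (simp add: penalized_objective_def G xX)
  have lower': "f (x k) + \<mu> k * e \<le> penalized_objective M \<xi> g p f (lam k) (\<mu> k) (x k, \<eta> k)"
    if "0 \<le> e" "count_le n (a (x k)) e < p * n" for k e
    using G_emp_penalty_ge[of n p "a (x k)" e "\<mu> k" "lam k" "\<eta> k"] that mu[of k] assms(7,10,11)
      less_imp_le[OF assms(14)[of k]]
    by (simp add: penalized_objective_def G xX)

  obtain r where r: "strict_mono r" "((\<lambda>k. (x k, \<eta> k)) \<circ> r) \<longlonglongrightarrow> (xbar, \<eta>bar)"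
    using assms(18) unfolding cluster_point_def by blast
  have xlim: "(\<lambda>k. x (r k)) \<longlonglongrightarrow> xbar"
    using tendsto_fst[OF r(2)] by (simp add: o_def)
  \<comment> \<open>A finite convex function on a finite-dimensional space is continuous; the same
    applies to \<open>g\<close> in its first argument.\<close>
  have flim: "(\<lambda>k. f (x (r k))) \<longlonglongrightarrow> f xbar"
    by (rule continuous_on_tendsto_compose[OF convex_on_continuous[OF open_UNIV assms(2)] xlim]) auto
  have alim: "(\<lambda>k. a (x (r k)) i) \<longlonglongrightarrow> a xbar i" for i
    unfolding a_def
    by (rule continuous_on_tendsto_compose[OF convex_on_continuous[OF open_UNIV assms(3)] xlim]) auto
  have xbar: "xbar \<in> X"
    using closed_sequentially[OF assms(1) _ xlim] xX by blast
  have feasible: "p * n \<le> count_le n (a xbar) 0"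
  proof (rule ccontr)
    assume neg: "\<not> p * n \<le> count_le n (a xbar) 0"
    obtain y t where y: "y \<in> X" "t \<le> 0" "\<And>s. G_emp n p (a y) t \<le> G_emp n p (a y) s"
      using assms(12) unfolding bilevel_feasible_def by (auto simp: is_arg_min_linorder G)
    let ?S = "{i\<in>{1..n}. 0 < a xbar i}"
    \<comment> \<open>The aim is a level \<open>e\<close> strictly between 0 and all positive values
      \<open>a xbar i\<close>. It stays below the quantile at \<open>x (r k)\<close> for large
      \<open>k\<close>.\<close>
    have "\<forall>\<^sub>F e in at_right 0. \<forall>i\<in>?S. e < a xbar i"
      by (intro eventually_ball_finite ballI order_tendstoD(2)[OF tendsto_ident_at]) auto
    then have "\<forall>\<^sub>F e in at_right (0::real). 0 < e \<and> (\<forall>i\<in>?S. e < a xbar i)"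
      using eventually_at_right_less[of "0::real"] by eventually_elim auto
    then obtain e where e: "0 < e" "\<And>i. i \<in> ?S \<Longrightarrow> e < a xbar i"
      using eventually_happens'[OF trivial_limit_at_right_real] by blast
    have "\<forall>\<^sub>F k in sequentially. \<forall>i\<in>?S. e < a (x (r k)) i"
      using alim e(2) by (intro eventually_ball_finite ballI) (auto dest: order_tendstoD(1))
    moreover have "\<forall>\<^sub>F k in sequentially. f xbar - 1 < f (x (r k))"
      using flim by (rule order_tendstoD(1)) simp
    \<comment> \<open>This threshold makes the penalty \<open>\<mu> (r k) * e\<close> outweigh the
      gap between the fixed bound \<open>f y\<close> and the eventual lower bound
      \<open>f xbar - 1\<close> of \<open>f (x (r k))\<close>.\<close>
    moreover have "\<forall>\<^sub>F k in sequentially. (f y - (f xbar - 1)) / e \<le> \<mu> (r k)"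
      using filterlim_compose[OF assms(15) filterlim_subseq[OF r(1)]] by (simp add: filterlim_at_top)
    ultimately have "\<forall>\<^sub>F k in sequentially. False"
    proof eventually_elim
      case (elim k)
      \<comment> \<open>An index with \<open>a xbar i > 0\<close> keeps its value above
        \<open>e\<close>, so only indices counted at \<open>xbar\<close> remain.\<close>
      have "count_le n (a (x (r k))) e \<le> count_le n (a xbar) 0"
        unfolding count_le_def using elim(1) by (intro card_mono) force+
      then have "count_le n (a (x (r k))) e < p * n"
        using neg by linarith
      then have "f (x (r k)) + \<mu> (r k) * e \<le> f y"
        using lower'[of e "r k"] upper[OF y, of "r k"] e(1) by linarith
      moreover have "f y - (f xbar - 1) \<le> \<mu> (r k) * e"
        using elim(3) e(1) by (simp add: pos_divide_le_eq)
      ultimately show False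
        using elim(2) by linarith
    qed
    then show False by simp
  qed
  have "f xbar \<le> f y" if y: "y \<in> X" "p * n \<le> count_le n (a y) 0" for y
  proof -
    \<comment> \<open>The chance constraint at \<open>y\<close> gives a nonpositive minimiser, so
      \<open>f y\<close> bounds every \<open>f (x k)\<close> and hence the limit.\<close>
    obtain t where "t \<le> 0" "\<And>s. G_emp n p (a y) t \<le> G_emp n p (a y) s"
      using G_emp_minimiser[OF assms(7,10,11) y(2)] by blast
    then have "f (x (r k)) \<le> f y" for k
      using upper[OF y(1)] lower order_trans by blast
    then show ?thesis
      by (intro LIMSEQ_le_const2[OF flim]) auto
  qed
  then show ?thesis
    using xbar feasible chance by (auto simp: is_arg_min_linorder)
qed

end
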